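(* Let the model and the weights $W=(w_1,\dots,w_n)$ be as in the context, let $\widetilde\theta$ be the local maximum likelihood estimate for $W$, and let $\theta\in\Theta$. Then for any $r>0$ and any $\lambda\in(0,1)$, $$N^r\,\mathbf E_{f(\cdot)}|\mathscr K(\widetilde\theta,\theta)|^r\le\sqrt{e^{\Delta(W,\theta)}\,\tau_{2r}},$$ $$N\bigl\{\mathbf E_{f(\cdot)}|\mathscr K(\widetilde\theta,\theta)|^r\bigr\}^{1/r}\le\frac1\lambda\Bigl\{\log\frac{2}{1-\lambda}+\Delta(W,\theta)+2(r-1)_+\Bigr\},$$ where $\tau_s=2s\int_0^\infty z^{s-1}e^{-z}\,dz=2s\,\Gamma(s)$ for $s>0$.
   Context: Model. $X_1,\dots,X_n\in\mathbb R^d$ are deterministic design points, and $Y_1,\dots,Y_n$ are independent real random variables with $Y_i\sim P_{f(X_i)}$, where $f:\mathbb R^d\to\Theta$ is an unknown function. $\mathbf P_{f(\cdot)},\mathbf E_{f(\cdot)}$ denote the joint law and expectation; $\mathbf P_\theta,\mathbf E_\theta$ denote those when $f\equiv\theta$. Standing assumptions. (A1) $(P_\theta,\theta\in\Theta\subseteq\mathbb R)$ is dominated by a measure $P$ with densities $p(y,\theta)=p(y)e^{yC(\theta)-B(\theta)}$, where $p(y)\ge 0$, $B,C$ are nondecreasing continuously differentiable functions on $\Theta$, and $\mathbf E_\theta Y=\theta$ for all $\theta\in\Theta$ (natural parametrization). (A2) $\Theta$ is compact and convex, and the Fisher information $I(\theta)=\mathbf E_\theta|\partial\log p(Y,\theta)/\partial\theta|^2$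 is positive and satisfies, for some $\varkappa\ge 1$, $|I(\theta')/I(\theta'')|^{1/2}\le\varkappa$ for all $\theta',\theta''\in\Theta$. $\mathscr K(\theta,\theta')=\mathbf E_\theta\log\{p(Y,\theta)/p(Y,\theta')\}$ is the Kullback–Leibler divergence. Weights and estimate. $W=(w_1,\dots,w_n)$ are deterministic weights, $w_i\in[0,1]$, $N=\sum_i w_i>0$. The local maximum likelihood estimate is $\widetilde\theta=\arg\max_{\theta\in\Theta}\sum_i w_i\log p(Y_i,\theta)$ (equal to $\sum_i w_iY_i/N$ whenever the latter lies in $\Theta$). Modeling bias. $\Delta(W,\theta)=\sum_i\delta(\theta,f(X_i))\mathbf 1(w_i>0)$, where $\delta(\theta,\theta')=\log \mathbf E_\theta\{p^2(Y,\theta')/p^2(Y,\theta)\}$, $Y\sim P_\theta$. $(a)_+=\max(a,0)$. *)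

theory Defs
  imports "HOL-Probability.Probability"
begin

definition pdens :: "(real \<Rightarrow> real) \<Rightarrow> (real \<Rightarrow> real) \<Rightarrow> (real \<Rightarrow> real) \<Rightarrow> real \<Rightarrow> real \<Rightarrow> real" where
  "pdens p C B y t = p y * exp (y * C t - B t)"

definition plaw :: "real measure \<Rightarrow> (real \<Rightarrow> real) \<Rightarrow> (real \<Rightarrow> real) \<Rightarrow> (real \<Rightarrow> real) \<Rightarrow> real \<Rightarrow> real measure"
  where "plaw P p C B t = density P (\<lambda>y. ennreal (pdens p C B y t))"

(* Derivatives are taken within the parameter set, so they are one-sided at its boundary. *)
definition cont_diff_on :: "real set \<Rightarrow> (real \<Rightarrow> real) \<Rightarrow> bool" where
  "cont_diff_on S g \<longleftrightarrow>
     (\<exists>g'. continuous_on S g' \<and> (\<forall>t\<in>S. (g has_real_derivative g' t) (at t within S)))"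

definition cond_A1 ::
  "real measure \<Rightarrow> (real \<Rightarrow> real) \<Rightarrow> (real \<Rightarrow> real) \<Rightarrow> (real \<Rightarrow> real) \<Rightarrow> real set \<Rightarrow> bool" where
  "cond_A1 P p C B \<Theta> \<longleftrightarrow>
     sets P = sets borel \<and> p \<in> borel_measurable P \<and> (\<forall>y. 0 \<le> p y) \<and>
     mono_on \<Theta> B \<and> mono_on \<Theta> C \<and> cont_diff_on \<Theta> B \<and> cont_diff_on \<Theta> C \<and>
     (\<forall>t\<in>\<Theta>. prob_space (plaw P p C B t) \<and>
        integrable (plaw P p C B t) (\<lambda>y. y) \<and> (\<integral>y. y \<partial>plaw P p C B t) = t)"

(* Where p y = 0, a null set for every law of the family, the logarithm below is ln 0 = 0. *)
definition fisher_info ::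
  "real measure \<Rightarrow> (real \<Rightarrow> real) \<Rightarrow> (real \<Rightarrow> real) \<Rightarrow> (real \<Rightarrow> real) \<Rightarrow> real set \<Rightarrow> real \<Rightarrow> real" where
  "fisher_info P p C B \<Theta> t =
     (\<integral>y. \<bar>vector_derivative (\<lambda>s. ln (pdens p C B y s)) (at t within \<Theta>)\<bar>\<^sup>2 \<partial>plaw P p C B t)"

(* A Bochner integral is 0 when the integrand is not integrable, so positivity of the Fisher
   information also says that it is finite. *)
definition cond_A2 ::
  "real measure \<Rightarrow> (real \<Rightarrow> real) \<Rightarrow> (real \<Rightarrow> real) \<Rightarrow> (real \<Rightarrow> real) \<Rightarrow> real set \<Rightarrow> bool" where
  "cond_A2 P p C B \<Theta> \<longleftrightarrow>
     compact \<Theta> \<and> convex \<Theta> \<and> (\<forall>t\<in>\<Theta>. 0 < fisher_info P p C B \<Theta> t) \<and>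
     (\<exists>\<kappa>\<ge>1. \<forall>t'\<in>\<Theta>. \<forall>t''\<in>\<Theta>.
        sqrt \<bar>fisher_info P p C B \<Theta> t' / fisher_info P p C B \<Theta> t''\<bar> \<le> \<kappa>)"

definition KL ::
  "real measure \<Rightarrow> (real \<Rightarrow> real) \<Rightarrow> (real \<Rightarrow> real) \<Rightarrow> (real \<Rightarrow> real) \<Rightarrow> real \<Rightarrow> real \<Rightarrow> real" where
  "KL P p C B t t' = (\<integral>y. ln (pdens p C B y t / pdens p C B y t') \<partial>plaw P p C B t)"

(* y collects the observations.  The maximizer is unique unless p (y i) = 0 for every i with
   w i > 0, which has probability zero; arg_max_on then makes an arbitrary choice. *)
definition local_mle ::
  "(real \<Rightarrow> real) \<Rightarrow> (real \<Rightarrow> real) \<Rightarrow> (real \<Rightarrow> real) \<Rightarrow> real set \<Rightarrow> nat \<Rightarrow> (nat \<Rightarrow> real) \<Rightarrow> (nat \<Rightarrow> real) \<Rightarrow> real"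
  where "local_mle p C B \<Theta> n w y =
     arg_max_on (\<lambda>t. \<Sum>i\<in>{1..n}. w i * ln (pdens p C B (y i) t)) \<Theta>"

definition ln_ennreal :: "ennreal \<Rightarrow> ereal" where
  "ln_ennreal x = (if x = 0 then -\<infinity> else if x = \<infinity> then \<infinity> else ereal (ln (enn2real x)))"

definition exp_ereal :: "ereal \<Rightarrow> ereal" where
  "exp_ereal x = (case x of ereal a \<Rightarrow> ereal (exp a) | PInfty \<Rightarrow> \<infinity> | MInfty \<Rightarrow> 0)"

(* Only used for nonnegative arguments. *)
definition sqrt_ereal :: "ereal \<Rightarrow> ereal" where
  "sqrt_ereal x = (case x of ereal a \<Rightarrow> ereal (sqrt a) | PInfty \<Rightarrow> \<infinity> | MInfty \<Rightarrow> -\<infinity>)"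

(* Extended-valued: the second moment of the likelihood ratio may be infinite. *)
definition chi_div ::
  "real measure \<Rightarrow> (real \<Rightarrow> real) \<Rightarrow> (real \<Rightarrow> real) \<Rightarrow> (real \<Rightarrow> real) \<Rightarrow> real \<Rightarrow> real \<Rightarrow> ereal" where
  "chi_div P p C B t t' =
     ln_ennreal (\<integral>\<^sup>+y. ennreal ((pdens p C B y t')\<^sup>2 / (pdens p C B y t)\<^sup>2) \<partial>plaw P p C B t)"

(* g i is the value of the unknown function at the i-th design point. *)
definition modeling_bias ::
  "real measure \<Rightarrow> (real \<Rightarrow> real) \<Rightarrow> (real \<Rightarrow> real) \<Rightarrow> (real \<Rightarrow> real) \<Rightarrow> nat \<Rightarrow> (nat \<Rightarrow> real) \<Rightarrow> (nat \<Rightarrow> real) \<Rightarrow> real \<Rightarrow> ereal"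
  where "modeling_bias P p C B n g w t =
     (\<Sum>i\<in>{1..n}. if w i > 0 then chi_div P p C B t (g i) else 0)"

definition tau :: "real \<Rightarrow> real" where
  "tau s = 2 * s * integral {0..} (\<lambda>z. z powr (s - 1) * exp (- z))"

lemma tau_eq_Gamma: "s > 0 \<Longrightarrow> tau s = 2 * s * Gamma s"
  unfolding tau_def
  using integral_unique[OF Gamma_integral_real[of s]] by (simp add: exp_minus field_simps)

end

theory Submission
  imports Defs
begin

text \<open>
  Nonnegativity of the Kullback--Leibler divergence gives
  \<open>s (C t - C s) \<le> B t - B s \<le> t (C t - C s)\<close>. Hence \<open>C\<close> is strictly increasing, the
  weighted likelihood is maximized by the projection of \<open>\<Sum>w\<^sub>i Y\<^sub>i / N\<close> to \<open>\<Theta>\<close>, and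
  \<open>N K(\<theta>est, \<theta>)\<close> is at most the log-likelihood ratio of \<open>\<theta>est\<close> to \<open>\<theta>\<close>. Since
  \<open>K(\<cdot>, \<theta>)\<close> is monotone on either side of \<open>\<theta>\<close>, the event \<open>N K(\<theta>est, \<theta>) > z\<close> is contained
  in the union of two events \<open>L(t) \<ge> z\<close> with deterministic \<open>t\<close>, and Markov's inequality with
  \<open>E\<^sub>\<theta> exp L(t) \<le> 1\<close> (Jensen, as \<open>w\<^sub>i \<le> 1\<close>) bounds its probability by \<open>2 exp(-z)\<close> under
  the parametric law \<open>\<theta>\<close>. Integration gives \<open>E\<^sub>\<theta> U\<^sup>s \<le> \<tau>\<^sub>s\<close> and \<open>E\<^sub>\<theta> exp(\<lambda> U) \<le> 2 / (1 - \<lambda>)\<close>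
  for \<open>U = N K(\<theta>est, \<theta>)\<close>. The Cauchy--Schwarz inequality with the likelihood ratio \<open>Z\<close>, for
  which \<open>E\<^sub>\<theta> Z\<^sup>2 = exp \<Delta>\<close>, transfers the bounds for \<open>U\<^sup>2\<^sup>r\<close> and \<open>exp(\<lambda> U)\<close> to bounds for
  \<open>U\<^sup>r\<close> and \<open>exp(\<lambda> U / 2)\<close> under the true law. The second claim then follows from Jensen's
  inequality for \<open>x \<mapsto> (log x)\<^sup>r\<close>, concave where \<open>log x \<ge> (r - 1)\<^sub>+\<close>.
\<close>

subsection \<open>Moments, tails and product measures\<close>

text \<open>Tonelli's theorem exchanges the integrals. The tail bound concerns the strict
  inequality, so the closed interval is first replaced by a half-open one; they differ at most in
  the null set \<open>{U x}\<close>.\<close>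

lemma nn_integral_layer_cake_le:
  fixes U :: "'a \<Rightarrow> real" and h g :: "real \<Rightarrow> ennreal"
  assumes Q: "sigma_finite_measure Q"
    and [measurable]: "U \<in> borel_measurable Q" "h \<in> borel_measurable borel"
    and tail: "\<And>z. 0 \<le> z \<Longrightarrow> emeasure Q {x\<in>space Q. z < U x} \<le> g z"
  shows "(\<integral>\<^sup>+x. (\<integral>\<^sup>+z. h z * indicator {0..U x} z \<partial>lborel) \<partial>Q)
     \<le> (\<integral>\<^sup>+z. h z * g z * indicator {0..} z \<partial>lborel)"
proof -
  interpret Q: sigma_finite_measure Q by fact
  interpret QL: pair_sigma_finite Q lborel
    by (intro pair_sigma_finite.intro Q sigma_finite_lborel)
  have "(\<integral>\<^sup>+x. (\<integral>\<^sup>+z. h z * indicator {0..U x} z \<partial>lborel) \<partial>Q)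
     = (\<integral>\<^sup>+x. (\<integral>\<^sup>+z. (if 0 \<le> z \<and> z < U x then h z else 0) \<partial>lborel) \<partial>Q)"
  proof (rule nn_integral_cong, rule nn_integral_cong_AE)
    fix x
    show "AE z in lborel. h z * indicator {0..U x} z = (if 0 \<le> z \<and> z < U x then h z else 0)"
      using AE_lborel_singleton[of "U x"] by eventually_elim (auto simp: indicator_def)
  qed
  also have "\<dots> = (\<integral>\<^sup>+z. (\<integral>\<^sup>+x. (if 0 \<le> z \<and> z < U x then h z else 0) \<partial>Q) \<partial>lborel)"
    by (rule QL.Fubini'[symmetric]) measurable
  also have "\<dots> \<le> (\<integral>\<^sup>+z. h z * g z * indicator {0..} z \<partial>lborel)"
  proof (rule nn_integral_mono)
    fix z :: real
    show "(\<integral>\<^sup>+x. (if 0 \<le> z \<and> z < U x then h z else 0) \<partial>Q) \<le> h z * g z * indicator {0..} z"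
    proof (cases "0 \<le> z")
      case True
      have "(\<integral>\<^sup>+x. (if 0 \<le> z \<and> z < U x then h z else 0) \<partial>Q)
          = (\<integral>\<^sup>+x. h z * indicator {x\<in>space Q. z < U x} x \<partial>Q)"
        by (intro nn_integral_cong) (auto simp: True indicator_def)
      also have "\<dots> = h z * emeasure Q {x\<in>space Q. z < U x}"
        by (rule nn_integral_cmult_indicator) measurable
      also have "\<dots> \<le> h z * g z"
        by (intro mult_left_mono tail True) auto
      finally show ?thesis using True by simp
    qed simp
  qed
  finally show ?thesis .
qed

text \<open>Layer cake with density \<open>s * z powr (s - 1)\<close>, whose integral over
  \<open>{0..U x}\<close> is \<open>U x powr s\<close>; the tail bound turns the outer integral into
  a Gamma integral.\<close>

lemma powr_moment_le_tau:
  fixes U :: "'a \<Rightarrow> real"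
  assumes Q: "sigma_finite_measure Q" and U[measurable]: "U \<in> borel_measurable Q"
    and nonneg: "\<And>x. x \<in> space Q \<Longrightarrow> 0 \<le> U x"
    and tail: "\<And>z. 0 \<le> z \<Longrightarrow> emeasure Q {x\<in>space Q. z < U x} \<le> ennreal (2 * exp (- z))"
    and s: "0 < s"
  shows "(\<integral>\<^sup>+x. ennreal (U x powr s) \<partial>Q) \<le> ennreal (tau s)"
proof -
  let ?h = "\<lambda>z::real. ennreal (s * z powr (s - 1))"
  have "(\<integral>\<^sup>+x. ennreal (U x powr s) \<partial>Q) = (\<integral>\<^sup>+x. (\<integral>\<^sup>+z. ?h z * indicator {0..U x} z \<partial>lborel) \<partial>Q)"
  proof (intro nn_integral_cong)
    fix x assume "x \<in> space Q"
    then have "0 \<le> U x" by (rule nonneg)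
    from has_integral_mult_right[OF has_integral_powr_from_0[OF _ this, of "s - 1"], of s]
    have I: "((\<lambda>z. s * z powr (s - 1)) has_integral (U x powr s)) {0..U x}" using s by simp
    from nn_integral_has_integral_lebesgue[OF _ I] s
    show "ennreal (U x powr s) = (\<integral>\<^sup>+z. ?h z * indicator {0..U x} z \<partial>lborel)"
      by (simp add: nn_integral_completion indicator_mult_ennreal ac_simps)
  qed
  also have "\<dots> \<le> (\<integral>\<^sup>+z. ?h z * ennreal (2 * exp (- z)) * indicator {0..} z \<partial>lborel)"
    by (intro nn_integral_layer_cake_le Q U tail) measurable
  also have "\<dots> = ennreal (tau s)"
  proof -
    from has_integral_mult_right[OF Gamma_integral_real[OF s], of "2 * s"]
    have I: "((\<lambda>z. 2 * s * (z powr (s - 1) / exp z)) has_integral tau s) {0..}"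
      by (simp add: tau_eq_Gamma s)
    have "(\<integral>\<^sup>+z. ?h z * ennreal (2 * exp (- z)) * indicator {0..} z \<partial>lborel)
       = (\<integral>\<^sup>+z. indicator {0..} z * (2 * s * (z powr (s - 1) / exp z)) \<partial>lborel)"
      using s by (intro nn_integral_cong)
        (auto simp: indicator_def ennreal_mult'[symmetric] exp_minus field_simps)
    with nn_integral_has_integral_lebesgue[OF _ I] s show ?thesis
      by simp
  qed
  finally show ?thesis .
qed

text \<open>Layer cake with density \<open>lam * exp (lam * z)\<close> for
  \<open>exp (lam * U x) - 1\<close>; the remaining 1 is the mass of \<open>Q\<close>.\<close>

lemma exp_moment_le:
  fixes U :: "'a \<Rightarrow> real"
  assumes Q: "prob_space Q" and U[measurable]: "U \<in> borel_measurable Q"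
    and nonneg: "\<And>x. x \<in> space Q \<Longrightarrow> 0 \<le> U x"
    and tail: "\<And>z. 0 \<le> z \<Longrightarrow> emeasure Q {x\<in>space Q. z < U x} \<le> ennreal (2 * exp (- z))"
    and lam: "0 < lam" "lam < 1"
  shows "(\<integral>\<^sup>+x. ennreal (exp (lam * U x)) \<partial>Q) \<le> ennreal (2 / (1 - lam))"
proof -
  interpret prob_space Q by fact
  let ?h = "\<lambda>z::real. ennreal (lam * exp (lam * z))"
  have "(\<integral>\<^sup>+x. ennreal (exp (lam * U x)) \<partial>Q)
      = (\<integral>\<^sup>+x. 1 + (\<integral>\<^sup>+z. ?h z * indicator {0..U x} z \<partial>lborel) \<partial>Q)"
  proof (intro nn_integral_cong)
    fix x assume "x \<in> space Q"
    then have "0 \<le> U x" by (rule nonneg)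
    then have "(\<integral>\<^sup>+z. ?h z * indicator {0..U x} z \<partial>lborel) = exp (lam * U x) - exp (lam * 0)"
      using lam by (intro nn_integral_FTC_Icc) (auto intro!: derivative_eq_intros)
    then show "ennreal (exp (lam * U x)) = 1 + (\<integral>\<^sup>+z. ?h z * indicator {0..U x} z \<partial>lborel)"
      using \<open>0 \<le> U x\<close> lam by (simp add: ennreal_1[symmetric] ennreal_plus[symmetric] del: ennreal_1 ennreal_plus)
  qed
  also have "\<dots> = 1 + (\<integral>\<^sup>+x. (\<integral>\<^sup>+z. ?h z * indicator {0..U x} z \<partial>lborel) \<partial>Q)"
  proof -
    \<comment> \<open>Writing the indicator as a conditional makes the joint measurability in
      \<open>x\<close> and \<open>z\<close> accessible.\<close>
    have "(\<lambda>x. \<integral>\<^sup>+z. (if 0 \<le> z \<and> z \<le> U x then ?h z else 0) \<partial>lborel) \<in> borel_measurable Q"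
      by (rule lborel.borel_measurable_nn_integral) measurable
    also have "(\<lambda>x. \<integral>\<^sup>+z. (if 0 \<le> z \<and> z \<le> U x then ?h z else 0) \<partial>lborel)
      = (\<lambda>x. \<integral>\<^sup>+z. ?h z * indicator {0..U x} z \<partial>lborel)"
      by (intro ext nn_integral_cong) (auto simp: indicator_def)
    finally have "(\<lambda>x. \<integral>\<^sup>+z. ?h z * indicator {0..U x} z \<partial>lborel) \<in> borel_measurable Q" .
    then show ?thesis by (subst nn_integral_add) (auto simp: emeasure_space_1)
  qed
  also have "(\<integral>\<^sup>+x. (\<integral>\<^sup>+z. ?h z * indicator {0..U x} z \<partial>lborel) \<partial>Q)
      \<le> (\<integral>\<^sup>+z. ?h z * ennreal (2 * exp (- z)) * indicator {0..} z \<partial>lborel)"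
    by (intro nn_integral_layer_cake_le U tail) (auto intro: sigma_finite_measure_axioms)
  also have "\<dots> = (\<integral>\<^sup>+z. ennreal (2 * lam * exp (- (1 - lam) * z)) * indicator {0..} z \<partial>lborel)"
    using lam by (intro nn_integral_cong)
      (auto simp: ennreal_mult'[symmetric] exp_add[symmetric] algebra_simps mult_exp_exp)
  also have "\<dots> = 0 - (- (2 * lam / (1 - lam)) * exp (- (1 - lam) * 0))"
  proof (rule nn_integral_FTC_atLeast)
    fix z :: real
    have "((\<lambda>z. c * exp (- (1 - lam) * z)) has_real_derivative
        (- (1 - lam) * c) * exp (- (1 - lam) * z)) (at z)" for c
      by (auto intro!: derivative_eq_intros)
    moreover have "- (1 - lam) * (- (2 * lam / (1 - lam))) = 2 * lam"
      using lam by (simp add: field_simps)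
    ultimately
    show "((\<lambda>z. - (2 * lam / (1 - lam)) * exp (- (1 - lam) * z)) has_real_derivative
        2 * lam * exp (- (1 - lam) * z)) (at z)"
      by metis
    show "((\<lambda>z. - (2 * lam / (1 - lam)) * exp (- (1 - lam) * z)) \<longlongrightarrow> 0) at_top"
      using lam by (intro tendsto_mult_right_zero filterlim_compose[OF exp_at_bot]
        filterlim_tendsto_neg_mult_at_bot[OF tendsto_const _ filterlim_ident]) auto
  qed (use lam in auto)
  finally have "(\<integral>\<^sup>+x. ennreal (exp (lam * U x)) \<partial>Q) \<le> 1 + ennreal (2 * lam / (1 - lam))"
    by (simp add: add_left_mono)
  also have "\<dots> = ennreal (1 + 2 * lam / (1 - lam))"
    using lam by (subst ennreal_plus) auto
  \<comment> \<open>The bound obtained equals \<open>(1 + lam) / (1 - lam)\<close> and is rounded up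
    by \<open>lam < 1\<close>.\<close>
  also have "\<dots> \<le> ennreal (2 / (1 - lam))"
  proof (rule ennreal_leI)
    have "1 + 2 * lam / (1 - lam) = (1 + lam) / (1 - lam)"
      using lam by (simp add: field_simps)
    also have "\<dots> \<le> 2 / (1 - lam)"
      using lam by (intro divide_right_mono) auto
    finally show "1 + 2 * lam / (1 - lam) \<le> 2 / (1 - lam)" .
  qed
  finally show ?thesis .
qed

text \<open>Tangent-line form of the concavity of \<open>x \<mapsto> (ln x) powr r\<close> where \<open>ln x \<ge> max (r - 1) 0\<close>;
  here \<open>u = ln x\<close>.\<close>

lemma powr_le_exp_tangent:
  fixes u a r :: real
  assumes r: "0 < r" and u: "max (r - 1) 0 \<le> u" and a: "max (r - 1) 0 \<le> a" "0 < a"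
  shows "u powr r \<le> a powr r + r * a powr (r - 1) * (exp (u - a) - 1)"
\<comment> \<open>The derivative of \<open>v powr r\<close> is used for positive \<open>v\<close>
  only. At \<open>u = 0\<close> the hypotheses force \<open>r \<le> 1\<close>, and
  \<open>1 - a \<le> exp (- a)\<close> suffices.\<close>
proof (cases "u = 0")
  case True
  have "0 \<le> (1 - r) * a powr r" using True u by simp
  moreover have "a powr r = a powr (r - 1) * a" using a by (simp add: powr_diff)
  moreover have "r * a powr (r - 1) * (1 - a) \<le> r * a powr (r - 1) * exp (- a)"
    using r exp_ge_add_one_self[of "- a"] by (intro mult_left_mono) auto
  ultimately show ?thesis using True by (simp add: algebra_simps)
next
  case False
  then have u0: "0 < u" using u by simp
  \<comment> \<open>\<open>g\<close> is the gap in the claim and vanishes at \<open>a\<close>. Its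
    derivative at \<open>v\<close> is \<open>r * exp v\<close> times the value of
    \<open>x powr (r - 1) * exp (- x)\<close> at \<open>a\<close> minus that at \<open>v\<close>. By
    \<open>dec\<close> this function decreases for positive \<open>x \<ge> r - 1\<close>, so
    \<open>g\<close> falls before \<open>a\<close> and rises after it.\<close>
  define g where "g v = a powr r + r * a powr (r - 1) * (exp (v - a) - 1) - v powr r" for v
  define g' where "g' v = r * a powr (r - 1) * exp (v - a) - r * v powr (r - 1)" for v
  have D: "(g has_real_derivative g' v) (at v)" if "0 < v" for v
    unfolding g_def g'_def using that a by (auto intro!: derivative_eq_intros)
  have dec: "y powr (r - 1) \<le> x powr (r - 1) * exp (y - x)"
    if x: "0 < x" "r - 1 \<le> x" and xy: "x \<le> y" for x y
  proof -
    have "(r - 1) * (ln y - ln x) \<le> y - x"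
    proof (cases "1 \<le> r")
      case True
      have "ln y - ln x \<le> (y - x) / x"
        using ln_le_minus_one[of "y / x"] x xy by (simp add: ln_div diff_divide_distrib)
      then have "(r - 1) * (ln y - ln x) \<le> (r - 1) * ((y - x) / x)"
        using True by (intro mult_left_mono) auto
      also have "\<dots> \<le> x * ((y - x) / x)"
        using x xy by (intro mult_right_mono) auto
      finally show ?thesis using x by simp
    next
      case False
      then have "(r - 1) * (ln y - ln x) \<le> 0"
        using x xy by (intro mult_nonpos_nonneg) auto
      then show ?thesis using xy by linarith
    qed
    then show ?thesis using x xy
      by (simp add: powr_def mult_exp_exp algebra_simps)
  qed
  have "g a \<le> g u"
  proof (cases "a \<le> u")
    case True
    show ?thesis
    proof (rule DERIV_nonneg_imp_nondecreasing[OF True])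
      fix v assume v: "a \<le> v" "v \<le> u"
      have "0 \<le> g' v" unfolding g'_def
        using mult_left_mono[OF dec[of a v], of r] a v r by (simp add: mult.assoc)
      then show "\<exists>y. DERIV g v :> y \<and> 0 \<le> y" using D[of v] a v by auto
    qed
  next
    case False
    show ?thesis
    proof (rule DERIV_nonpos_imp_nonincreasing[of u a])
      fix v assume v: "u \<le> v" "v \<le> a"
      have "a powr (r - 1) * exp (v - a) \<le> (v powr (r - 1) * exp (a - v)) * exp (v - a)"
        using dec[of v a] u u0 v by (intro mult_right_mono) auto
      also have "\<dots> = v powr (r - 1)" by (simp add: mult.assoc mult_exp_exp)
      finally have "g' v \<le> 0" unfolding g'_def
        using mult_left_mono[of "a powr (r - 1) * exp (v - a)" "v powr (r - 1)" r] r
        by (simp add: mult.assoc)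
      then show "\<exists>y. DERIV g v :> y \<and> y \<le> 0" using D[of v] u0 v by auto
    qed (use False in simp)
  qed
  then show ?thesis by (simp add: g_def)
qed

text \<open>A product measure is determined on boxes, and there the indicator splits into a product
  over the coordinates, so the integral factorizes.\<close>

lemma PiM_density:
  fixes N :: "'i \<Rightarrow> 'a measure" and f :: "'i \<Rightarrow> 'a \<Rightarrow> ennreal"
  assumes N: "product_sigma_finite N" and D: "product_sigma_finite (\<lambda>i. density (N i) (f i))"
    and J: "finite J" and f[measurable]: "\<And>i. i \<in> J \<Longrightarrow> f i \<in> borel_measurable (N i)"
  shows "PiM J (\<lambda>i. density (N i) (f i)) = density (PiM J N) (\<lambda>x. \<Prod>i\<in>J. f i (x i))"
proof (rule product_sigma_finite.PiM_eqI[OF D J, symmetric])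
  show "sets (density (PiM J N) (\<lambda>x. \<Prod>i\<in>J. f i (x i))) = sets (PiM J (\<lambda>i. density (N i) (f i)))"
    unfolding sets_density by (rule sets_PiM_cong) simp_all
next
  fix A assume "\<And>i. i \<in> J \<Longrightarrow> A i \<in> sets (density (N i) (f i))"
  then have A[measurable]: "\<And>i. i \<in> J \<Longrightarrow> A i \<in> sets (N i)" by simp
  have prod_meas: "(\<lambda>x. \<Prod>i\<in>J. f i (x i)) \<in> borel_measurable (PiM J N)"
    by (intro borel_measurable_prod_ennreal
        measurable_comp[OF measurable_component_singleton, unfolded comp_def] f)
  have "emeasure (density (PiM J N) (\<lambda>x. \<Prod>i\<in>J. f i (x i))) (Pi\<^sub>E J A)
      = (\<integral>\<^sup>+x. (\<Prod>i\<in>J. f i (x i)) * indicator (Pi\<^sub>E J A) x \<partial>PiM J N)"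
    by (rule emeasure_density[OF prod_meas sets_PiM_I_finite[OF J A]])
  also have "\<dots> = (\<integral>\<^sup>+x. (\<Prod>i\<in>J. f i (x i) * indicator (A i) (x i)) \<partial>PiM J N)"
  proof (rule nn_integral_cong)
    fix x assume x: "x \<in> space (PiM J N)"
    show "(\<Prod>i\<in>J. f i (x i)) * indicator (Pi\<^sub>E J A) x = (\<Prod>i\<in>J. f i (x i) * indicator (A i) (x i))"
    proof (cases "x \<in> Pi\<^sub>E J A")
      case True
      then have "x i \<in> A i" if "i \<in> J" for i using that by (rule PiE_mem)
      then show ?thesis using True by simp
    next
      case False
      then obtain i where "i \<in> J" "x i \<notin> A i"
        using x by (auto simp: space_PiM PiE_iff)
      then have "(\<Prod>i\<in>J. f i (x i) * indicator (A i) (x i)) = 0"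
        using J by (intro prod_zero bexI[of _ i]) auto
      then show ?thesis using False by simp
    qed
  qed
  also have "\<dots> = (\<Prod>i\<in>J. \<integral>\<^sup>+x. f i x * indicator (A i) x \<partial>N i)"
    by (rule product_sigma_finite.product_nn_integral_prod[OF N J, of "\<lambda>i x. f i x * indicator (A i) x"])
      measurable
  also have "\<dots> = (\<Prod>i\<in>J. emeasure (density (N i) (f i)) (A i))"
    by (intro prod.cong refl emeasure_density[symmetric]) auto
  finally show "emeasure (density (PiM J N) (\<lambda>x. \<Prod>i\<in>J. f i (x i))) (Pi\<^sub>E J A)
    = (\<Prod>i\<in>J. emeasure (density (N i) (f i)) (A i))" .
qed

text \<open>Jensen's inequality for \<open>(ln x) powr r\<close> at
  \<open>x = exp (\<kappa> * U + c)\<close>, carried out by integrating the tangent line at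
  \<open>x = exp A\<close>. The shift \<open>c = max (r - 1) 0\<close> moves all values into the
  range of concavity.\<close>

lemma powr_moment_le_of_exp_moment:
  fixes U :: "'a \<Rightarrow> real"
  assumes R: "prob_space R" and U[measurable]: "U \<in> borel_measurable R"
    and nonneg: "\<And>x. x \<in> space R \<Longrightarrow> 0 \<le> U x"
    and "0 < r" "0 < \<kappa>" and A: "max (r - 1) 0 < A"
    and exp_moment: "(\<integral>\<^sup>+x. ennreal (exp (\<kappa> * U x)) \<partial>R) \<le> ennreal (exp (A - max (r - 1) 0))"
  shows "(\<integral>\<^sup>+x. ennreal (U x powr r) \<partial>R) \<le> ennreal ((A / \<kappa>) powr r)"
proof -
  interpret prob_space R by fact
  define c where "c = max (r - 1) 0"
  define d where "d = r * A powr (r - 1)"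
  have A0: "0 < A" "c \<le> A" and c0: "0 \<le> c" using A by (auto simp: c_def)
  have d0: "0 \<le> d" using \<open>0 < r\<close> by (simp add: d_def)
  have tangent: "\<kappa> powr r * U x powr r + d \<le> A powr r + d * exp (c - A) * exp (\<kappa> * U x)"
    if x: "x \<in> space R" for x
  proof -
    have "(\<kappa> * U x) powr r \<le> (\<kappa> * U x + c) powr r"
      using nonneg[OF x] \<open>0 < \<kappa>\<close> \<open>0 < r\<close> c0 by (intro powr_mono2) auto
    also have "\<dots> \<le> A powr r + d * (exp (\<kappa> * U x + c - A) - 1)"
      unfolding d_def using nonneg[OF x] \<open>0 < \<kappa>\<close> \<open>0 < r\<close> A0
      by (intro powr_le_exp_tangent) (auto simp: c_def)
    finally show ?thesis using nonneg[OF x] \<open>0 < \<kappa>\<close>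
      by (simp add: powr_mult mult_exp_exp algebra_simps)
  qed
  \<comment> \<open>Keeping \<open>d\<close> on the left avoids subtraction in
    \<open>ennreal\<close>. The exponential moment bound makes the last term on the right at most
    \<open>d\<close>, and the two cancel.\<close>
  have "ennreal (\<kappa> powr r) * (\<integral>\<^sup>+x. ennreal (U x powr r) \<partial>R) + ennreal d
      = (\<integral>\<^sup>+x. ennreal (\<kappa> powr r * U x powr r + d) \<partial>R)"
    using d0 by (simp add: nn_integral_add nn_integral_cmult ennreal_mult'' emeasure_space_1 ennreal_plus)
  also have "\<dots> \<le> (\<integral>\<^sup>+x. ennreal (A powr r + d * exp (c - A) * exp (\<kappa> * U x)) \<partial>R)"
    by (intro nn_integral_mono ennreal_leI tangent)
  also have "\<dots> = ennreal (A powr r) + ennreal (d * exp (c - A)) * (\<integral>\<^sup>+x. ennreal (exp (\<kappa> * U x)) \<partial>R)"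
    using d0 by (simp add: nn_integral_add nn_integral_cmult ennreal_mult'' emeasure_space_1 ennreal_plus)
  also have "\<dots> \<le> ennreal (A powr r) + ennreal (d * exp (c - A)) * ennreal (exp (A - c))"
    using exp_moment by (intro add_left_mono mult_left_mono) (auto simp: c_def)
  also have "ennreal (d * exp (c - A)) * ennreal (exp (A - c)) = ennreal d"
    using d0 by (simp add: ennreal_mult''[symmetric] mult_exp_exp mult.assoc)
  finally have "ennreal (\<kappa> powr r) * (\<integral>\<^sup>+x. ennreal (U x powr r) \<partial>R) \<le> ennreal (A powr r)"
    using ennreal_add_left_cancel_le[of "ennreal d"] by (simp only: add.commute[of _ "ennreal d"]) auto
  then have "ennreal (1 / \<kappa> powr r) * (ennreal (\<kappa> powr r) * (\<integral>\<^sup>+x. ennreal (U x powr r) \<partial>R))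
      \<le> ennreal (1 / \<kappa> powr r) * ennreal (A powr r)"
    by (intro mult_left_mono) auto
  then show ?thesis
    using \<open>0 < \<kappa>\<close> A0
    by (simp add: mult.assoc[symmetric] ennreal_mult''[symmetric] powr_divide)
qed

text \<open>Factors of at least 1 exclude both \<open>0 * \<infinity>\<close> and
  \<open>-\<infinity> + \<infinity>\<close>.\<close>

lemma ln_ennreal_mult: "1 \<le> x \<Longrightarrow> 1 \<le> y \<Longrightarrow> ln_ennreal (x * y) = ln_ennreal x + ln_ennreal y"
  by (cases x; cases y)
     (auto simp: ln_ennreal_def ennreal_mult_top ennreal_top_mult ennreal_mult'[symmetric] ln_mult
       simp flip: ennreal_1)

lemma prod_ge_one_ennreal: "(\<And>i. i \<in> J \<Longrightarrow> 1 \<le> c i) \<Longrightarrow> 1 \<le> (\<Prod>i\<in>J. c i :: ennreal)"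
  using prod_mono_ennreal[of J "\<lambda>_. 1" c] by simp

lemma sum_ln_ennreal:
  "finite J \<Longrightarrow> (\<And>i. i \<in> J \<Longrightarrow> 1 \<le> c i) \<Longrightarrow> (\<Sum>i\<in>J. ln_ennreal (c i)) = ln_ennreal (\<Prod>i\<in>J. c i)"
proof (induction J rule: finite_induct)
  case empty
  then show ?case by (simp add: ln_ennreal_def)
next
  case (insert i J)
  then show ?case by (simp add: ln_ennreal_mult prod_ge_one_ennreal)
qed

lemma ennreal_power2_le_imp_le:
  assumes "x\<^sup>2 \<le> (ennreal e)\<^sup>2" "0 \<le> e"
  shows "x \<le> ennreal e"
proof (cases x)
  case (real u)
  then have "u\<^sup>2 \<le> e\<^sup>2" using assms by (simp add: ennreal_power)
  then show ?thesis using real assms(2) by (auto intro: ennreal_leI power2_le_imp_le)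
next
  case top
  then show ?thesis using assms by (simp add: ennreal_power top_power_ennreal top_unique)
qed

subsection \<open>Exponential families in the mean parametrization\<close>

locale natural_exp_family =
  fixes P :: "real measure" and p C B :: "real \<Rightarrow> real" and a b :: real
  assumes A1: "cond_A1 P p C B {a..b}" and a_le_b: "a \<le> b"
begin

abbreviation law :: "real \<Rightarrow> real measure" where "law \<equiv> plaw P p C B"

text \<open>The Kullback-Leibler divergence in closed form: the log-likelihood ratio is affine in
  the observation, whose mean under \<open>law s\<close> is \<open>s\<close> (see
  \<open>KL_eq_K\<close>).\<close>

definition K :: "real \<Rightarrow> real \<Rightarrow> real" where
  "K s t = s * (C s - C t) - (B s - B t)"

definition clamp :: "real \<Rightarrow> real" where "clamp x = max a (min b x)"

lemma clamp_in: "clamp x \<in> {a..b}"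
  using a_le_b by (auto simp: clamp_def)

lemma clamp_measurable [measurable]: "clamp \<in> borel_measurable borel"
  unfolding clamp_def by measurable

lemma sets_P [measurable_cong, simp]: "sets P = sets borel"
  using A1 by (simp add: cond_A1_def)

lemma p_measurable [measurable]: "p \<in> borel_measurable borel"
  using A1 measurable_cong_sets[OF sets_P refl] by (auto simp: cond_A1_def)

lemma p_nonneg: "0 \<le> p y"
  using A1 by (simp add: cond_A1_def)

lemma pdens_nonneg: "0 \<le> pdens p C B y t"
  by (simp add: pdens_def p_nonneg)

lemma pdens_measurable [measurable]: "(\<lambda>y. pdens p C B y t) \<in> borel_measurable borel"
  unfolding pdens_def by measurable

lemma sets_law [measurable_cong, simp]: "sets (law t) = sets borel"
  by (simp add: plaw_def)

lemma space_law [simp]: "space (law t) = UNIV"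
  using sets_eq_imp_space_eq[OF sets_law] by simp

lemma prob_space_law: "t \<in> {a..b} \<Longrightarrow> prob_space (law t)"
  and integrable_law: "t \<in> {a..b} \<Longrightarrow> integrable (law t) (\<lambda>y. y)"
  and mean_law: "t \<in> {a..b} \<Longrightarrow> (\<integral>y. y \<partial>law t) = t"
  using A1 by (auto simp: cond_A1_def)

lemma nn_integral_law:
  assumes [measurable]: "f \<in> borel_measurable borel"
  shows "(\<integral>\<^sup>+y. f y \<partial>law t) = (\<integral>\<^sup>+y. ennreal (pdens p C B y t) * f y \<partial>P)"
  unfolding plaw_def by (rule nn_integral_density) measurable

text \<open>Disposes of the conventions \<open>ln 0 = 0\<close> and \<open>0 / 0 = 0\<close>, which
  matter only at zeros of \<open>p\<close>.\<close>

lemma AE_law_p_pos: "AE y in law t. 0 < p y"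
  unfolding plaw_def by (subst AE_density) (auto simp: pdens_def p_nonneg zero_less_mult_iff)

text \<open>The exponential is the density ratio of \<open>law s\<close> to \<open>law t\<close>, so
  weighting it by the density of \<open>law t\<close> leaves the total mass of
  \<open>law s\<close>.\<close>

lemma nn_integral_likelihood_ratio:
  assumes "s \<in> {a..b}"
  shows "(\<integral>\<^sup>+y. ennreal (exp (y * (C s - C t) - (B s - B t))) \<partial>law t) = 1"
proof -
  have "(\<integral>\<^sup>+y. ennreal (exp (y * (C s - C t) - (B s - B t))) \<partial>law t) = (\<integral>\<^sup>+y. 1 \<partial>law s)"
    by (simp add: nn_integral_law ennreal_mult'[symmetric] p_nonneg pdens_def mult_exp_exp
        algebra_simps del: nn_integral_const)
  also have "\<dots> = 1"
    using prob_space.emeasure_space_1[OF prob_space_law[OF assms]] by simp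
  finally show ?thesis .
qed

text \<open>Integrate \<open>1 + x \<le> exp x\<close> against \<open>law s\<close>, with
  \<open>x\<close> the log-likelihood ratio of \<open>t\<close> to \<open>s\<close>:
  \<open>exp x\<close> has mean 1 and \<open>x\<close> has mean \<open>- K s t\<close>.\<close>

lemma K_nonneg:
  assumes s: "s \<in> {a..b}" and t: "t \<in> {a..b}"
  shows "0 \<le> K s t"
proof -
  interpret prob_space "law s" by (rule prob_space_law[OF s])
  let ?X = "\<lambda>y. y * (C t - C s) - (B t - B s)"
  have int: "integrable (law s) (\<lambda>y. exp (?X y))"
    by (rule integrableI_nonneg) (use nn_integral_likelihood_ratio[OF t, of s] in auto)
  have "(\<integral>y. 1 + ?X y \<partial>law s) \<le> (\<integral>y. exp (?X y) \<partial>law s)"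
    by (intro integral_mono int Bochner_Integration.integrable_add Bochner_Integration.integrable_diff
        integrable_mult_left integrable_law s exp_ge_add_one_self) auto
  also have "\<dots> = 1"
    using nn_integral_likelihood_ratio[OF t, of s] int by (simp add: integral_eq_nn_integral)
  also have "(\<integral>y. 1 + ?X y \<partial>law s) = 1 + (s * (C t - C s) - (B t - B s))"
    using integrable_law[OF s] by (simp add: mean_law[OF s] prob_space[unfolded space_law])
  finally show ?thesis by (simp add: K_def algebra_simps)
qed

lemma KL_eq_K:
  assumes s: "s \<in> {a..b}"
  shows "KL P p C B s t = K s t"
proof -
  interpret prob_space "law s" by (rule prob_space_law[OF s])
  have "KL P p C B s t = (\<integral>y. y * (C s - C t) - (B s - B t) \<partial>law s)"
    unfolding KL_def
  proof (rule integral_cong_AE)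
    show "AE y in law s. ln (pdens p C B y s / pdens p C B y t) = y * (C s - C t) - (B s - B t)"
      using AE_law_p_pos
      by eventually_elim (simp add: pdens_def exp_diff[symmetric] algebra_simps)
  qed measurable
  also have "\<dots> = K s t"
    using integrable_law[OF s] by (simp add: K_def mean_law[OF s] prob_space[unfolded space_law])
  finally show ?thesis .
qed

text \<open>A finite-difference counterpart of the relation \<open>B' t = t * C' t\<close>, read off
  from \<open>K_nonneg\<close> in both orders of the arguments.\<close>

lemma B_diff_bounds:
  assumes "s \<in> {a..b}" "t \<in> {a..b}"
  shows "s * (C t - C s) \<le> B t - B s" "B t - B s \<le> t * (C t - C s)"
  using K_nonneg[OF assms] K_nonneg[OF assms(2,1)] by (auto simp: K_def algebra_simps)

text \<open>Identifiability: equal values of \<open>C\<close> would force equal values of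
  \<open>B\<close>, hence one law with two different means.\<close>

lemma C_strict_mono:
  assumes s: "s \<in> {a..b}" and t: "t \<in> {a..b}" and "s < t"
  shows "C s < C t"
proof -
  have "C s \<noteq> C t"
  proof
    assume eq: "C s = C t"
    then have "B s = B t" using B_diff_bounds[OF s t] by simp
    with eq have "law s = law t" by (simp add: plaw_def pdens_def)
    then have "s = t" using mean_law[OF s] mean_law[OF t] by metis
    with \<open>s < t\<close> show False by simp
  qed
  moreover have "C s \<le> C t"
    using A1 mono_onD[of "{a..b}" C s t] s t \<open>s < t\<close> by (simp add: cond_A1_def)
  ultimately show ?thesis by simp
qed

lemma C_mono: "s \<in> {a..b} \<Longrightarrow> t \<in> {a..b} \<Longrightarrow> s \<le> t \<Longrightarrow> C s \<le> C t"
  using C_strict_mono[of s t] by (cases "s = t") auto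

text \<open>Cutting at an intermediate \<open>u\<close> improves the factor on one of the two
  pieces, and strict monotonicity of \<open>C\<close> makes the improvement strict.\<close>

lemma B_diff_strict_bounds:
  assumes s: "s \<in> {a..b}" and t: "t \<in> {a..b}" and "s < t"
  shows "s * (C t - C s) < B t - B s" "B t - B s < t * (C t - C s)"
proof -
  obtain u where u: "s < u" "u < t" using dense[OF \<open>s < t\<close>] by auto
  then have uab: "u \<in> {a..b}" using s t by auto
  have su: "s * (C u - C s) \<le> B u - B s" "B u - B s \<le> u * (C u - C s)"
    by (rule B_diff_bounds[OF s uab])+
  have ut: "u * (C t - C u) \<le> B t - B u" "B t - B u \<le> t * (C t - C u)"
    by (rule B_diff_bounds[OF uab t])+
  have less: "s * (C t - C u) < u * (C t - C u)" "u * (C u - C s) < t * (C u - C s)"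
    using u C_strict_mono[OF s uab] C_strict_mono[OF uab t] by (simp_all add: mult_strict_right_mono)
  have split: "v * (C t - C s) = v * (C t - C u) + v * (C u - C s)" for v
    by (simp add: algebra_simps)
  show "s * (C t - C s) < B t - B s"
    using su ut less split[of s] by linarith
  show "B t - B s < t * (C t - C s)"
    using su ut less split[of t] by linarith
qed

text \<open>By the upper bound on \<open>B t - B s\<close> the increment is at least
  \<open>(t - s) * (C s - C \<theta>)\<close>, whose factors never have opposite signs here.\<close>

lemma K_mono:
  assumes "\<theta> \<in> {a..b}" "s \<in> {a..b}" "t \<in> {a..b}"
    and "\<theta> \<le> s \<and> s \<le> t \<or> t \<le> s \<and> s \<le> \<theta>"
  shows "K s \<theta> \<le> K t \<theta>"
proof -
  have "0 \<le> (t - s) * (C s - C \<theta>)"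
    using assms C_mono[of s \<theta>] C_mono[of \<theta> s] by (auto simp: zero_le_mult_iff)
  then show ?thesis
    using B_diff_bounds[OF assms(2,3)] by (simp add: K_def algebra_simps)
qed

lemma continuous_on_C: "continuous_on {a..b} C" and continuous_on_B: "continuous_on {a..b} B"
  using A1 by (auto simp: cond_A1_def cont_diff_on_def intro: DERIV_continuous_on)

lemma continuous_on_K: "continuous_on {a..b} (\<lambda>t. K t \<theta>)"
  unfolding K_def by (intro continuous_intros continuous_on_C continuous_on_B)

text \<open>Continuity of \<open>C\<close> and \<open>B\<close> is known on \<open>{a..b}\<close>
  only; composing with \<open>clamp\<close> gives a function continuous on the whole line.\<close>

lemma K_clamp_measurable [measurable]: "(\<lambda>x. K (clamp x) \<theta>) \<in> borel_measurable borel"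
proof (rule borel_measurable_continuous_onI)
  have "continuous_on UNIV clamp" unfolding clamp_def by (intro continuous_intros)
  then show "continuous_on UNIV (\<lambda>x. K (clamp x) \<theta>)"
    by (rule continuous_on_compose2[OF continuous_on_K]) (use clamp_in in blast)
qed

lemma K_bounded: "\<exists>c. \<forall>t\<in>{a..b}. K t \<theta> \<le> c"
proof -
  have "bounded ((\<lambda>t. K t \<theta>) ` {a..b})"
    by (intro compact_imp_bounded compact_continuous_image continuous_on_K) simp
  then show ?thesis by (auto simp: bounded_iff abs_le_iff)
qed

text \<open>Let \<open>m = clamp (S / N)\<close>. If \<open>t < m\<close> then
  \<open>m \<le> S / N\<close>, so moving from \<open>t\<close> to \<open>m\<close> raises the first
  term by at least \<open>N * m * (C m - C t)\<close>, while the second costs strictly less. The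
  other side is symmetric.\<close>

lemma clamp_maximizes:
  assumes N: "0 < N" and t: "t \<in> {a..b}" "t \<noteq> clamp (S / N)"
  shows "S * C t - N * B t < S * C (clamp (S / N)) - N * B (clamp (S / N))"
proof -
  define m where "m = clamp (S / N)"
  have m: "m \<in> {a..b}" unfolding m_def by (rule clamp_in)
  consider "t < m" | "m < t" using t m_def by fastforce
  then show ?thesis
  proof cases
    case 1
    then have "m \<le> S / N" using t by (auto simp: m_def clamp_def max_def min_def split: if_splits)
    then have "N * m \<le> S" using N by (simp add: field_simps)
    then have "N * m * (C m - C t) \<le> S * (C m - C t)"
      using C_strict_mono[OF t(1) m 1] by (intro mult_right_mono) auto
    moreover have "N * (B m - B t) < N * (m * (C m - C t))"
      using B_diff_strict_bounds(2)[OF t(1) m 1] N by simp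
    ultimately show ?thesis unfolding m_def[symmetric] by (simp add: algebra_simps)
  next
    case 2
    then have "S / N \<le> m" using t by (auto simp: m_def clamp_def max_def min_def split: if_splits)
    then have "S \<le> N * m" using N by (simp add: field_simps)
    then have "S * (C t - C m) \<le> N * m * (C t - C m)"
      using C_strict_mono[OF m t(1) 2] by (intro mult_right_mono) auto
    moreover have "N * (m * (C t - C m)) < N * (B t - B m)"
      using B_diff_strict_bounds(1)[OF m t(1) 2] N by simp
    ultimately show ?thesis unfolding m_def[symmetric] by (simp add: algebra_simps)
  qed
qed

text \<open>Covering every sample, this formula gives measurability of the estimate. By
  \<open>ln 0 = 0\<close>, observations with \<open>p (y i) = 0\<close> drop out of the objective.
  If no weight remains, the objective is the zero function, so the arbitrary choice does not depend
  on \<open>y\<close>.\<close>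

lemma local_mle_eq:
  fixes w y :: "nat \<Rightarrow> real"
  assumes w: "\<forall>i\<in>{1..n}. 0 \<le> w i"
  defines "S \<equiv> \<Sum>i\<in>{1..n}. if 0 < p (y i) then w i * y i else 0"
    and "N \<equiv> \<Sum>i\<in>{1..n}. if 0 < p (y i) then w i else 0"
  shows "local_mle p C B {a..b} n w y =
    (if 0 < N then clamp (S / N) else arg_max_on (\<lambda>_. 0::real) {a..b})"
proof -
  define c where "c = (\<Sum>i\<in>{1..n}. if 0 < p (y i) then w i * ln (p (y i)) else 0)"
  have "w i * ln (pdens p C B (y i) t) =
      (if 0 < p (y i) then w i * ln (p (y i)) else 0) + C t * (if 0 < p (y i) then w i * y i else 0)
      - B t * (if 0 < p (y i) then w i else 0)" for i t
    using p_nonneg[of "y i"] by (cases "p (y i) = 0") (auto simp: pdens_def ln_mult algebra_simps)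
  then have obj: "(\<Sum>i\<in>{1..n}. w i * ln (pdens p C B (y i) t)) = c + (S * C t - N * B t)" for t
    by (simp only: c_def S_def N_def sum.distrib sum_subtractf sum_distrib_left[symmetric] mult.commute)
  have N0: "0 \<le> N" unfolding N_def using w by (intro sum_nonneg) auto
  show ?thesis
  proof (cases "0 < N")
    case True
    have "is_arg_max (\<lambda>t. c + (S * C t - N * B t)) (\<lambda>t. t \<in> {a..b}) = (\<lambda>t. t = clamp (S / N))"
      using clamp_maximizes[OF True, of _ S] clamp_in[of "S / N"]
      unfolding is_arg_max_def by (intro ext) (smt (verit, best))
    then show ?thesis
      using True by (simp only: local_mle_def obj arg_max_on_def arg_max_def if_True some_eq_trivial)
  next
    case False
    then have "N = 0" using N0 by simp
    then have "\<forall>i\<in>{1..n}. (if 0 < p (y i) then w i else 0) = 0"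
      unfolding N_def using w by (subst (asm) sum_nonneg_eq_0_iff) auto
    then have "S = 0" "c = 0" unfolding S_def c_def
      by (auto intro!: sum.neutral split: if_splits)
    then show ?thesis using \<open>N = 0\<close> unfolding local_mle_def obj by simp
  qed
qed

lemma arg_max_on_const_in: "arg_max_on (\<lambda>_. 0::real) {a..b} \<in> {a..b}"
proof -
  have "is_arg_max (\<lambda>_. 0::real) (\<lambda>x. x \<in> {a..b}) a"
    using a_le_b by (simp add: is_arg_max_def)
  then have "is_arg_max (\<lambda>_. 0::real) (\<lambda>x. x \<in> {a..b}) (arg_max_on (\<lambda>_. 0::real) {a..b})"
    unfolding arg_max_on_def arg_max_def by (rule someI)
  then show ?thesis by (simp add: is_arg_max_def)
qed

lemma local_mle_in:
  assumes "\<forall>i\<in>{1..n}. 0 \<le> w i"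
  shows "local_mle p C B {a..b} n w y \<in> {a..b}"
  by (subst local_mle_eq[OF assms]) (auto simp del: atLeastAtMost_iff intro: arg_max_on_const_in clamp_in)

lemma local_mle_measurable:
  assumes w: "\<forall>i\<in>{1..n}. 0 \<le> w i"
    and [measurable]: "\<And>i. i \<in> {1..n} \<Longrightarrow> Y i \<in> borel_measurable M"
  shows "(\<lambda>\<omega>. local_mle p C B {a..b} n w (\<lambda>i. Y i \<omega>)) \<in> borel_measurable M"
  unfolding local_mle_eq[OF w] by measurable

subsection \<open>Deviations under the parametric law and change of measure\<close>

lemma product_sigma_finite_law:
  assumes "\<And>i. g i \<in> {a..b}"
  shows "product_sigma_finite (\<lambda>i. law (g i))"
  unfolding product_sigma_finite_def
  using prob_space_law[OF assms] by (auto intro: prob_space_imp_sigma_finite)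

text \<open>After factorization over \<open>J\<close>, convexity bounds \<open>exp (w i * X)\<close>
  by \<open>(1 - w i) + w i * exp X\<close>, and the likelihood ratio \<open>exp X\<close> has mean
  1.\<close>

lemma log_likelihood_exp_moment_le_one:
  fixes w :: "'i \<Rightarrow> real"
  assumes J: "finite J" and w: "\<And>i. i \<in> J \<Longrightarrow> 0 \<le> w i \<and> w i \<le> 1"
    and t: "t \<in> {a..b}" and \<theta>: "\<theta> \<in> {a..b}"
  shows "(\<integral>\<^sup>+y. ennreal (exp (\<Sum>i\<in>J. w i * (y i * (C t - C \<theta>) - (B t - B \<theta>)))) \<partial>PiM J (\<lambda>_. law \<theta>)) \<le> 1"
proof -
  interpret prob_space "law \<theta>" by (rule prob_space_law[OF \<theta>])
  interpret product_sigma_finite "\<lambda>_. law \<theta>" by (rule product_sigma_finite_law[OF \<theta>])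
  let ?X = "\<lambda>x. x * (C t - C \<theta>) - (B t - B \<theta>)"
  have "(\<integral>\<^sup>+y. ennreal (exp (\<Sum>i\<in>J. w i * ?X (y i))) \<partial>PiM J (\<lambda>_. law \<theta>))
      = (\<integral>\<^sup>+y. (\<Prod>i\<in>J. ennreal (exp (w i * ?X (y i)))) \<partial>PiM J (\<lambda>_. law \<theta>))"
    by (simp add: exp_sum J prod_ennreal)
  also have "\<dots> = (\<Prod>i\<in>J. \<integral>\<^sup>+x. ennreal (exp (w i * ?X x)) \<partial>law \<theta>)"
    by (rule product_nn_integral_prod[OF J, of "\<lambda>i x. ennreal (exp (w i * ?X x))"]) measurable
  also have "\<dots> \<le> (\<Prod>i\<in>J. 1)"
  proof (rule prod_mono_ennreal)
    fix i assume i: "i \<in> J"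
    have "(\<integral>\<^sup>+x. ennreal (exp (w i * ?X x)) \<partial>law \<theta>)
        \<le> (\<integral>\<^sup>+x. ennreal (1 - w i) + ennreal (w i) * ennreal (exp (?X x)) \<partial>law \<theta>)"
    proof (rule nn_integral_mono)
      fix x
      have "exp (w i * ?X x) \<le> (1 - w i) + w i * exp (?X x)"
        using convex_onD[OF exp_convex, of "w i" 0 "?X x"] w[OF i] by simp
      then have "ennreal (exp (w i * ?X x)) \<le> ennreal ((1 - w i) + w i * exp (?X x))"
        by (rule ennreal_leI)
      also have "\<dots> = ennreal (1 - w i) + ennreal (w i) * ennreal (exp (?X x))"
        using w[OF i] by (simp add: ennreal_mult'')
      finally show "ennreal (exp (w i * ?X x)) \<le> ennreal (1 - w i) + ennreal (w i) * ennreal (exp (?X x))" .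
    qed
    also have "\<dots> = ennreal (1 - w i) + ennreal (w i)"
      using nn_integral_likelihood_ratio[OF t, of \<theta>] emeasure_space_1
      by (simp add: nn_integral_add nn_integral_cmult)
    also have "\<dots> = 1" using w[OF i] by (simp add: ennreal_plus[symmetric] del: ennreal_plus)
    finally show "(\<integral>\<^sup>+x. ennreal (exp (w i * ?X x)) \<partial>law \<theta>) \<le> 1" .
  qed
  finally show ?thesis by simp
qed

lemma log_likelihood_tail:
  fixes w :: "'i \<Rightarrow> real"
  assumes J: "finite J" and w: "\<And>i. i \<in> J \<Longrightarrow> 0 \<le> w i \<and> w i \<le> 1"
    and t: "t \<in> {a..b}" and \<theta>: "\<theta> \<in> {a..b}"
  defines "Q \<equiv> PiM J (\<lambda>_. law \<theta>)"
  shows "emeasure Q {y \<in> space Q. z \<le> (\<Sum>i\<in>J. w i * (y i * (C t - C \<theta>) - (B t - B \<theta>)))} \<le> ennreal (exp (- z))"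
proof -
  let ?L = "\<lambda>y. \<Sum>i\<in>J. w i * (y i * (C t - C \<theta>) - (B t - B \<theta>))"
  have [measurable]: "?L \<in> borel_measurable Q"
    unfolding Q_def by measurable
  have "{y \<in> space Q. z \<le> ?L y} = {y \<in> space Q. 1 \<le> ennreal (exp (- z)) * ennreal (exp (?L y))}"
    by (auto simp: ennreal_mult''[symmetric] mult_exp_exp simp flip: ennreal_1)
  then have "emeasure Q {y \<in> space Q. z \<le> ?L y}
      \<le> ennreal (exp (- z)) * (\<integral>\<^sup>+y. ennreal (exp (?L y)) * indicator (space Q) y \<partial>Q)"
    using nn_integral_Markov_inequality[of "\<lambda>y. ennreal (exp (?L y))" "space Q" Q "ennreal (exp (- z))"] by simp
  also have "(\<integral>\<^sup>+y. ennreal (exp (?L y)) * indicator (space Q) y \<partial>Q) = (\<integral>\<^sup>+y. ennreal (exp (?L y)) \<partial>Q)"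
    by (intro nn_integral_cong) simp
  also have "ennreal (exp (- z)) * (\<integral>\<^sup>+y. ennreal (exp (?L y)) \<partial>Q) \<le> ennreal (exp (- z)) * 1"
    unfolding Q_def by (intro mult_left_mono log_likelihood_exp_moment_le_one J w t \<theta>) auto
  finally show ?thesis by simp
qed

text \<open>The point \<open>t\<close> must not depend on \<open>m\<close>; it solves
  \<open>N * K t \<theta> = z\<close> by the intermediate value theorem. The final expression is
  nondecreasing in \<open>m\<close>, because \<open>C \<theta> \<le> C t\<close>, and equals
  \<open>z\<close> at \<open>m = t\<close>. By \<open>K_mono\<close>, a divergence above the level
  forces \<open>t \<le> m\<close>.\<close>

lemma K_clamp_exceeds_right:
  assumes \<theta>: "\<theta> \<in> {a..b}" and N: "0 < N" and z: "0 \<le> z"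
  shows "\<exists>t\<in>{a..b}. \<forall>m. \<theta> \<le> clamp m \<longrightarrow> z < N * K (clamp m) \<theta> \<longrightarrow> z \<le> N * (m * (C t - C \<theta>) - (B t - B \<theta>))"
proof (cases "z \<le> N * K b \<theta>")
  case True
  have "\<exists>t\<ge>\<theta>. t \<le> b \<and> N * K t \<theta> = z"
  proof (rule IVT')
    show "N * K \<theta> \<theta> \<le> z" using z by (simp add: K_def)
    show "continuous_on {\<theta>..b} (\<lambda>t. N * K t \<theta>)"
      by (intro continuous_intros continuous_on_subset[OF continuous_on_K]) (use \<theta> in auto)
  qed (use True \<theta> in auto)
  then obtain t where t: "\<theta> \<le> t" "t \<le> b" "N * K t \<theta> = z" by auto
  then have tab: "t \<in> {a..b}" using \<theta> by auto
  show ?thesis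
  proof (intro bexI[OF _ tab] allI impI)
    fix m assume m: "\<theta> \<le> clamp m" "z < N * K (clamp m) \<theta>"
    have "t < clamp m"
      using K_mono[OF \<theta> clamp_in[of m] tab] m t N by (smt (verit) mult_left_mono)
    then have "t \<le> m" using tab by (auto simp: clamp_def)
    then have "t * (C t - C \<theta>) \<le> m * (C t - C \<theta>)"
      using C_mono[OF \<theta> tab t(1)] by (intro mult_right_mono) auto
    then have "K t \<theta> \<le> m * (C t - C \<theta>) - (B t - B \<theta>)" by (simp add: K_def)
    then show "z \<le> N * (m * (C t - C \<theta>) - (B t - B \<theta>))"
      using t(3) N by (metis mult_le_cancel_left_pos)
  qed
next
  \<comment> \<open>The level is never exceeded on this side, so any \<open>t\<close>
    serves.\<close>
  case False
  have b: "b \<in> {a..b}" using a_le_b by simp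
  have "N * K (clamp m) \<theta> \<le> z" if "\<theta> \<le> clamp m" for m
  proof -
    have "K (clamp m) \<theta> \<le> K b \<theta>"
      using that clamp_in[of m] by (intro K_mono \<theta> clamp_in b) auto
    then have "N * K (clamp m) \<theta> \<le> N * K b \<theta>" using N by simp
    then show ?thesis using False by simp
  qed
  then show ?thesis using \<theta> by (meson linorder_not_less)
qed

text \<open>Mirror image of the previous lemma: now \<open>C t \<le> C \<theta>\<close>, so the
  expression grows as \<open>m\<close> decreases.\<close>

lemma K_clamp_exceeds_left:
  assumes \<theta>: "\<theta> \<in> {a..b}" and N: "0 < N" and z: "0 \<le> z"
  shows "\<exists>t\<in>{a..b}. \<forall>m. clamp m \<le> \<theta> \<longrightarrow> z < N * K (clamp m) \<theta> \<longrightarrow> z \<le> N * (m * (C t - C \<theta>) - (B t - B \<theta>))"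
proof (cases "z \<le> N * K a \<theta>")
  case True
  have "\<exists>t\<ge>a. t \<le> \<theta> \<and> N * K t \<theta> = z"
  proof (rule IVT2')
    show "N * K \<theta> \<theta> \<le> z" using z by (simp add: K_def)
    show "continuous_on {a..\<theta>} (\<lambda>t. N * K t \<theta>)"
      by (intro continuous_intros continuous_on_subset[OF continuous_on_K]) (use \<theta> in auto)
  qed (use True \<theta> in auto)
  then obtain t where t: "a \<le> t" "t \<le> \<theta>" "N * K t \<theta> = z" by auto
  then have tab: "t \<in> {a..b}" using \<theta> by auto
  show ?thesis
  proof (intro bexI[OF _ tab] allI impI)
    fix m assume m: "clamp m \<le> \<theta>" "z < N * K (clamp m) \<theta>"
    have "clamp m < t"
      using K_mono[OF \<theta> clamp_in[of m] tab] m t N by (smt (verit) mult_left_mono)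
    then have "m \<le> t" using tab by (auto simp: clamp_def)
    then have "t * (C t - C \<theta>) \<le> m * (C t - C \<theta>)"
      using C_mono[OF tab \<theta> t(2)] by (intro mult_right_mono_neg) auto
    then have "K t \<theta> \<le> m * (C t - C \<theta>) - (B t - B \<theta>)" by (simp add: K_def)
    then show "z \<le> N * (m * (C t - C \<theta>) - (B t - B \<theta>))"
      using t(3) N by (metis mult_le_cancel_left_pos)
  qed
next
  case False
  have a: "a \<in> {a..b}" using a_le_b by simp
  have "N * K (clamp m) \<theta> \<le> z" if "clamp m \<le> \<theta>" for m
  proof -
    have "K (clamp m) \<theta> \<le> K a \<theta>"
      using that clamp_in[of m] by (intro K_mono \<theta> clamp_in a) auto
    then have "N * K (clamp m) \<theta> \<le> N * K a \<theta>" using N by simp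
    then show ?thesis using False by simp
  qed
  then show ?thesis using \<theta> by (meson linorder_not_less)
qed

lemma K_clamp_tail:
  fixes w :: "'i \<Rightarrow> real"
  assumes J: "finite J" and w: "\<And>i. i \<in> J \<Longrightarrow> 0 \<le> w i \<and> w i \<le> 1"
    and \<theta>: "\<theta> \<in> {a..b}" and z: "0 \<le> z"
  defines "Q \<equiv> PiM J (\<lambda>_. law \<theta>)" and "N \<equiv> \<Sum>i\<in>J. w i"
  assumes N: "0 < N"
  shows "emeasure Q {y \<in> space Q. z < N * K (clamp ((\<Sum>i\<in>J. w i * y i) / N)) \<theta>} \<le> ennreal (2 * exp (- z))"
proof -
  let ?L = "\<lambda>t y. \<Sum>i\<in>J. w i * (y i * (C t - C \<theta>) - (B t - B \<theta>))"
  let ?m = "\<lambda>y. (\<Sum>i\<in>J. w i * y i) / N"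
  \<comment> \<open>The log-likelihood ratio depends on the sample only through the weighted mean,
    so the two one-dimensional lemmas apply. Each side contributes one
    \<open>exp (- z)\<close>.\<close>
  have L: "?L t y = N * (?m y * (C t - C \<theta>) - (B t - B \<theta>))" for t y
    using N by (simp add: right_diff_distrib sum_subtractf N_def mult.assoc[symmetric] flip: sum_distrib_right)
  obtain t where t: "t \<in> {a..b}"
    "\<And>m. \<theta> \<le> clamp m \<Longrightarrow> z < N * K (clamp m) \<theta> \<Longrightarrow> z \<le> N * (m * (C t - C \<theta>) - (B t - B \<theta>))"
    using K_clamp_exceeds_right[OF \<theta> N z] by blast
  obtain s where s: "s \<in> {a..b}"
    "\<And>m. clamp m \<le> \<theta> \<Longrightarrow> z < N * K (clamp m) \<theta> \<Longrightarrow> z \<le> N * (m * (C s - C \<theta>) - (B s - B \<theta>))"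
    using K_clamp_exceeds_left[OF \<theta> N z] by blast
  have [measurable]: "{y \<in> space Q. z \<le> ?L u y} \<in> sets Q" for u
    unfolding Q_def by measurable
  have "emeasure Q {y \<in> space Q. z < N * K (clamp (?m y)) \<theta>}
      \<le> emeasure Q ({y \<in> space Q. z \<le> ?L t y} \<union> {y \<in> space Q. z \<le> ?L s y})"
  proof (rule emeasure_mono)
    show "{y \<in> space Q. z < N * K (clamp (?m y)) \<theta>} \<subseteq> {y \<in> space Q. z \<le> ?L t y} \<union> {y \<in> space Q. z \<le> ?L s y}"
      unfolding L using t(2) s(2) linear by blast
  qed measurable
  also have "\<dots> \<le> emeasure Q {y \<in> space Q. z \<le> ?L t y} + emeasure Q {y \<in> space Q. z \<le> ?L s y}"
    by (rule emeasure_subadditive) measurable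
  also have "\<dots> \<le> ennreal (exp (- z)) + ennreal (exp (- z))"
    unfolding Q_def by (intro add_mono log_likelihood_tail J w t s \<theta>) auto
  also have "\<dots> = ennreal (2 * exp (- z))"
    by (simp flip: ennreal_plus)
  finally show ?thesis .
qed

text \<open>One plus the chi-square divergence of \<open>law g\<close> from
  \<open>law \<theta>\<close>; \<open>chi_div\<close> is its logarithm. Working before the logarithm
  keeps products, possibly infinite, inside \<open>ennreal\<close>.\<close>

definition chi2 :: "real \<Rightarrow> real \<Rightarrow> ennreal" where
  "chi2 \<theta> g = (\<integral>\<^sup>+y. ennreal ((pdens p C B y g)\<^sup>2 / (pdens p C B y \<theta>)\<^sup>2) \<partial>law \<theta>)"

text \<open>Both densities vanish exactly where \<open>p\<close> does, so \<open>0 / 0 = 0\<close>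
  loses no mass.\<close>

lemma law_eq_density:
  "law g = density (law \<theta>) (\<lambda>y. ennreal (pdens p C B y g / pdens p C B y \<theta>))"
proof -
  have "ennreal (pdens p C B y \<theta>) * ennreal (pdens p C B y g / pdens p C B y \<theta>)
      = ennreal (pdens p C B y g)" for y
    using p_nonneg[of y] by (cases "p y = 0") (auto simp: ennreal_mult'[symmetric] pdens_def)
  then show ?thesis
    unfolding plaw_def by (subst density_density_eq) simp_all
qed

text \<open>Cauchy-Schwarz against the constant 1. The bound supplies the hypothesis of
  \<open>sum_ln_ennreal\<close> in \<open>modeling_bias_eq\<close>.\<close>

lemma chi2_ge_one:
  assumes g: "g \<in> {a..b}" and \<theta>: "\<theta> \<in> {a..b}"
  shows "1 \<le> chi2 \<theta> g"
proof -
  let ?r = "\<lambda>y. ennreal (pdens p C B y g / pdens p C B y \<theta>)"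
  have "(\<integral>\<^sup>+y. ?r y * 1 \<partial>law \<theta>) = emeasure (density (law \<theta>) ?r) UNIV"
    by (subst emeasure_density) auto
  also have "\<dots> = 1"
    using prob_space.emeasure_space_1[OF prob_space_law[OF g]] law_eq_density[of g \<theta>] by simp
  finally have "1 = (\<integral>\<^sup>+y. ?r y * 1 \<partial>law \<theta>)\<^sup>2" by simp
  also have "\<dots> \<le> (\<integral>\<^sup>+y. (?r y)\<^sup>2 \<partial>law \<theta>) * (\<integral>\<^sup>+y. 1\<^sup>2 \<partial>law \<theta>)"
    by (rule Cauchy_Schwarz_nn_integral) measurable
  also have "\<dots> = chi2 \<theta> g"
    using prob_space.emeasure_space_1[OF prob_space_law[OF \<theta>]]
    by (simp add: chi2_def ennreal_power pdens_nonneg power_divide)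
  finally show ?thesis .
qed

text \<open>Cauchy-Schwarz for \<open>f\<close> and the joint likelihood ratio, whose second moment
  factorizes. The squared form needs no root in \<open>ennreal\<close> and allows infinite
  factors.\<close>

lemma change_of_measure:
  fixes g :: "'i \<Rightarrow> real"
  assumes J: "finite J" and g: "\<And>i. g i \<in> {a..b}" and \<theta>: "\<theta> \<in> {a..b}"
    and f: "f \<in> borel_measurable (PiM J (\<lambda>_. borel))"
  shows "(\<integral>\<^sup>+y. f y \<partial>PiM J (\<lambda>i. law (g i)))\<^sup>2
      \<le> (\<integral>\<^sup>+y. (f y)\<^sup>2 \<partial>PiM J (\<lambda>_. law \<theta>)) * (\<Prod>i\<in>J. chi2 \<theta> (g i))"
proof -
  interpret product_sigma_finite "\<lambda>_. law \<theta>" by (rule product_sigma_finite_law[OF \<theta>])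
  let ?Q = "PiM J (\<lambda>_. law \<theta>)"
  let ?r = "\<lambda>i y. ennreal (pdens p C B y (g i) / pdens p C B y \<theta>)"
  let ?Z = "\<lambda>y. \<Prod>i\<in>J. ?r i (y i)"
  have "sets ?Q = sets (PiM J (\<lambda>_. borel))" by (intro sets_PiM_cong) auto
  then have [measurable]: "f \<in> borel_measurable ?Q" using f by (simp cong: measurable_cong_sets)
  have [measurable]: "?Z \<in> borel_measurable ?Q" by measurable
  have "PiM J (\<lambda>i. law (g i)) = PiM J (\<lambda>i. density (law \<theta>) (?r i))"
    using law_eq_density by simp
  also have "\<dots> = density ?Q ?Z"
  proof (rule PiM_density)
    show "product_sigma_finite (\<lambda>i. density (law \<theta>) (?r i))"
      using product_sigma_finite_law[OF g] by (simp flip: law_eq_density)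
  qed (use J in \<open>auto intro: product_sigma_finite_axioms\<close>)
  finally have "(\<integral>\<^sup>+y. f y \<partial>PiM J (\<lambda>i. law (g i))) = (\<integral>\<^sup>+y. f y * ?Z y \<partial>?Q)"
    by (simp add: nn_integral_density mult.commute)
  then have "(\<integral>\<^sup>+y. f y \<partial>PiM J (\<lambda>i. law (g i)))\<^sup>2 \<le> (\<integral>\<^sup>+y. (f y)\<^sup>2 \<partial>?Q) * (\<integral>\<^sup>+y. (?Z y)\<^sup>2 \<partial>?Q)"
    using Cauchy_Schwarz_nn_integral[of f ?Q ?Z] by simp
  also have "(\<integral>\<^sup>+y. (?Z y)\<^sup>2 \<partial>?Q) = (\<integral>\<^sup>+y. (\<Prod>i\<in>J. (?r i (y i))\<^sup>2) \<partial>?Q)"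
    by (simp add: prod_power_distrib)
  also have "\<dots> = (\<Prod>i\<in>J. \<integral>\<^sup>+y. (?r i y)\<^sup>2 \<partial>law \<theta>)"
    by (rule product_nn_integral_prod[OF J, of "\<lambda>i y. (?r i y)\<^sup>2"]) measurable
  also have "\<dots> = (\<Prod>i\<in>J. chi2 \<theta> (g i))"
    by (simp add: chi2_def ennreal_power pdens_nonneg power_divide)
  finally show ?thesis .
qed

lemma modeling_bias_eq:
  assumes g: "\<And>i. g i \<in> {a..b}" and \<theta>: "\<theta> \<in> {a..b}"
  shows "modeling_bias P p C B n g w \<theta> = ln_ennreal (\<Prod>i\<in>{i\<in>{1..n}. 0 < w i}. chi2 \<theta> (g i))"
proof -
  have "modeling_bias P p C B n g w \<theta> = (\<Sum>i\<in>{i\<in>{1..n}. 0 < w i}. ln_ennreal (chi2 \<theta> (g i)))"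
    unfolding modeling_bias_def chi_div_def chi2_def by (rule sum.inter_filter[symmetric]) simp
  also have "\<dots> = ln_ennreal (\<Prod>i\<in>{i\<in>{1..n}. 0 < w i}. chi2 \<theta> (g i))"
    by (intro sum_ln_ennreal chi2_ge_one g \<theta>) auto
  finally show ?thesis .
qed

end

subsection \<open>The moment bounds\<close>

theorem corollary2p6:
  fixes P :: "real measure" and p C B :: "real \<Rightarrow> real" and \<Theta> :: "real set"
    and M :: "'a measure" and n :: nat and X :: "nat \<Rightarrow> real ^ 'd"
    and f :: "real ^ 'd \<Rightarrow> real" and Y :: "nat \<Rightarrow> 'a \<Rightarrow> real"
    and w :: "nat \<Rightarrow> real" and N \<theta> r lam :: real
    and \<theta>est :: "'a \<Rightarrow> real" and \<Delta> :: ereal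
  assumes A1: "cond_A1 P p C B \<Theta>"
    and A2: "cond_A2 P p C B \<Theta>"
    and f: "\<forall>x. f x \<in> \<Theta>"
    and M: "prob_space M"
    and indep: "prob_space.indep_vars M (\<lambda>_. borel) Y {1..n}"
    and Y: "\<forall>i\<in>{1..n}. distr M borel (Y i) = plaw P p C B (f (X i))"
    and w: "\<forall>i\<in>{1..n}. 0 \<le> w i \<and> w i \<le> 1"
    and N: "N = (\<Sum>i\<in>{1..n}. w i)" "N > 0"
    and est: "\<theta>est = (\<lambda>\<omega>. local_mle p C B \<Theta> n w (\<lambda>i. Y i \<omega>))"
    and \<theta>: "\<theta> \<in> \<Theta>"
    and \<Delta>: "\<Delta> = modeling_bias P p C B n (\<lambda>i. f (X i)) w \<theta>"
    and r: "r > 0" and lam: "0 < lam" "lam < 1"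
  shows "integrable M (\<lambda>\<omega>. \<bar>KL P p C B (\<theta>est \<omega>) \<theta>\<bar> powr r) \<and>
    ereal (N powr r * (\<integral>\<omega>. \<bar>KL P p C B (\<theta>est \<omega>) \<theta>\<bar> powr r \<partial>M))
      \<le> sqrt_ereal (exp_ereal \<Delta> * ereal (tau (2 * r))) \<and>
    ereal (N * (\<integral>\<omega>. \<bar>KL P p C B (\<theta>est \<omega>) \<theta>\<bar> powr r \<partial>M) powr (1 / r))
      \<le> ereal (1 / lam) * (ereal (ln (2 / (1 - lam))) + \<Delta> + ereal (2 * max (r - 1) 0))"
proof -
  have "connected \<Theta>" "compact \<Theta>" using A2 by (auto simp: cond_A2_def convex_connected)
  then obtain a b where ab: "\<Theta> = {a..b}" by (meson connected_compact_interval_1)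
  then have \<theta>': "\<theta> \<in> {a..b}" using \<theta> by simp
  interpret natural_exp_family P p C B a b
    by standard (use A1 ab \<theta>' in auto)
  interpret prob_space M by (rule M)
  have g: "f (X i) \<in> {a..b}" for i using f ab by simp
  \<comment> \<open>Observations of weight zero do not affect the weighted mean. Leaving them out
    makes the price of the change of measure agree with \<open>\<Delta>\<close>, which counts
    positive weights only.\<close>
  define J where "J = {i\<in>{1..n}. 0 < w i}"
  have J: "finite J" "J \<subseteq> {1..n}" by (auto simp: J_def)
  have wJ: "0 \<le> w i \<and> w i \<le> 1" if "i \<in> J" for i using w that by (auto simp: J_def)
  have w0: "\<forall>i\<in>{1..n}. 0 \<le> w i" using w by auto
  have sum_J: "(\<Sum>i\<in>{1..n}. w i * x i) = (\<Sum>i\<in>J. w i * x i)" for x :: "nat \<Rightarrow> real"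
    using w by (intro sum.mono_neutral_right) (auto simp: J_def)
  have NJ: "N = (\<Sum>i\<in>J. w i)" using sum_J[of "\<lambda>_. 1"] by (simp add: N(1))
  then have "J \<noteq> {}" using N(2) by auto
  define Q where "Q = PiM J (\<lambda>_. law \<theta>)"
  define R where "R = PiM J (\<lambda>i. law (f (X i)))"
  define U where "U y = N * K (clamp ((\<Sum>i\<in>J. w i * y i) / N)) \<theta>" for y
  define T where "T \<omega> = (\<lambda>i\<in>J. Y i \<omega>)" for \<omega>
  define D where "D = (\<Prod>i\<in>J. chi2 \<theta> (f (X i)))"
  have D1: "1 \<le> D" unfolding D_def by (intro prod_ge_one_ennreal chi2_ge_one g \<theta>')
  have \<Delta>': "\<Delta> = ln_ennreal D"
    unfolding \<Delta> D_def J_def by (rule modeling_bias_eq[OF g \<theta>'])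
  have sets_QR: "sets Q = sets (PiM J (\<lambda>_. borel))" "sets R = sets (PiM J (\<lambda>_. borel))"
    unfolding Q_def R_def by (auto intro!: sets_PiM_cong)
  have U_meas: "U \<in> borel_measurable (PiM J (\<lambda>_. borel))"
    unfolding U_def by measurable
  have U_meas_QR: "U \<in> borel_measurable Q" "U \<in> borel_measurable R"
    using U_meas by (simp_all only: measurable_cong_sets[OF sets_QR(1) refl]
        measurable_cong_sets[OF sets_QR(2) refl])
  have U_nonneg: "0 \<le> U y" for y
    unfolding U_def using N(2) by (intro mult_nonneg_nonneg K_nonneg clamp_in \<theta>') auto
  have prob_Q: "prob_space Q" and prob_R: "prob_space R"
    unfolding Q_def R_def by (intro prob_space_PiM prob_space_law \<theta>' g)+
  have tail: "emeasure Q {y \<in> space Q. z < U y} \<le> ennreal (2 * exp (- z))" if "0 \<le> z" for z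
    unfolding Q_def U_def NJ
    by (rule K_clamp_tail[OF J(1) wJ \<theta>' that]) (use N(2) NJ in auto)
  have Ym[measurable]: "Y i \<in> borel_measurable M" if "i \<in> {1..n}" for i
    using indep that by (auto simp: indep_vars_def)
  have T_meas: "T \<in> measurable M (PiM J (\<lambda>_. borel))"
    unfolding T_def using J(2) Ym by (intro measurable_restrict) auto
  have distr_T: "distr M (PiM J (\<lambda>_. borel)) T = R"
  proof -
    have "distr M (PiM J (\<lambda>_. borel)) T = PiM J (\<lambda>i. distr M borel (Y i))"
      unfolding T_def using indep_vars_iff_distr_eq_PiM'[OF \<open>J \<noteq> {}\<close>, where X = Y and M' = "\<lambda>_. borel"]
        indep_vars_subset[OF indep J(2)] Ym[OF subsetD[OF J(2)]] by blast
    also have "\<dots> = R" unfolding R_def using Y J(2) by (intro PiM_cong) auto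
    finally show ?thesis .
  qed
  have pushforward: "(\<integral>\<^sup>+\<omega>. h (T \<omega>) \<partial>M) = (\<integral>\<^sup>+y. h y \<partial>R)"
    if "h \<in> borel_measurable (PiM J (\<lambda>_. borel))" for h
    unfolding distr_T[symmetric] using that by (simp add: nn_integral_distr[OF T_meas])

  define V where "V \<omega> = \<bar>KL P p C B (\<theta>est \<omega>) \<theta>\<bar> powr r" for \<omega>
  have est_in: "\<theta>est \<omega> \<in> {a..b}" for \<omega>
    unfolding est ab by (rule local_mle_in[OF w0])
  have clamp_est: "clamp (\<theta>est \<omega>) = \<theta>est \<omega>" for \<omega>
    using est_in[of \<omega>] by (auto simp: clamp_def)
  \<comment> \<open>The redundant \<open>clamp\<close> lets \<open>K_clamp_measurable\<close>
    apply.\<close>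
  have V_eq: "V \<omega> = K (clamp (\<theta>est \<omega>)) \<theta> powr r" for \<omega>
    unfolding V_def using est_in[of \<omega>] by (simp only: KL_eq_K clamp_est abs_of_nonneg K_nonneg \<theta>')
  have [measurable]: "\<theta>est \<in> borel_measurable M"
    unfolding est ab by (rule local_mle_measurable[OF w0 Ym])
  have V_meas[measurable]: "V \<in> borel_measurable M"
    unfolding V_eq by measurable
  obtain c where c: "\<And>t. t \<in> {a..b} \<Longrightarrow> K t \<theta> \<le> c" using K_bounded by blast
  have V_int: "integrable M V"
  proof (rule integrable_const_bound[where B = "c powr r"])
    show "AE \<omega> in M. norm (V \<omega>) \<le> c powr r"
      unfolding V_eq using c clamp_in K_nonneg[OF clamp_in \<theta>'] r
      by (intro AE_I2) (auto intro!: powr_mono2 simp del: atLeastAtMost_iff)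
  qed measurable
  define I where "I = (\<integral>\<omega>. V \<omega> \<partial>M)"
  have V_nonneg: "0 \<le> V \<omega>" for \<omega> by (simp add: V_def)
  then have I0: "0 \<le> I" unfolding I_def by (rule Bochner_Integration.integral_nonneg)
  have p_pos: "AE \<omega> in M. \<forall>i\<in>{1..n}. 0 < p (Y i \<omega>)"
  proof (rule AE_finite_allI)
    fix i assume i: "i \<in> {1..n}"
    have "AE y in distr M borel (Y i). 0 < p y"
      using AE_law_p_pos Y i by metis
    then show "AE \<omega> in M. 0 < p (Y i \<omega>)"
      using Ym[OF i] by (subst (asm) AE_distr_iff) auto
  qed simp
  \<comment> \<open>The identity is only almost sure: the estimate is the projected weighted mean
    when \<open>p\<close> is positive at all observations.\<close>
  have V_U: "AE \<omega> in M. N powr r * V \<omega> = U (T \<omega>) powr r"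
    using p_pos
  proof eventually_elim
    fix \<omega> assume pos: "\<forall>i\<in>{1..n}. 0 < p (Y i \<omega>)"
    have "(\<Sum>i\<in>{1..n}. if 0 < p (Y i \<omega>) then w i * Y i \<omega> else 0) = (\<Sum>i\<in>{1..n}. w i * Y i \<omega>)"
      "(\<Sum>i\<in>{1..n}. if 0 < p (Y i \<omega>) then w i else 0) = N"
      unfolding N(1) using pos by (auto intro!: sum.cong)
    then have "\<theta>est \<omega> = clamp ((\<Sum>i\<in>{1..n}. w i * Y i \<omega>) / N)"
      unfolding est ab local_mle_eq[OF w0] using N(2) by simp
    then have "\<theta>est \<omega> = clamp ((\<Sum>i\<in>J. w i * T \<omega> i) / N)"
      unfolding sum_J by (simp add: T_def)
    then have "U (T \<omega>) = N * K (clamp (\<theta>est \<omega>)) \<theta>"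
      unfolding clamp_est by (simp add: U_def)
    then show "N powr r * V \<omega> = U (T \<omega>) powr r"
      unfolding V_eq using N(2) K_nonneg[OF clamp_in \<theta>'] by (simp add: powr_mult)
  qed
  have I_R: "ennreal (N powr r * I) = (\<integral>\<^sup>+y. ennreal (U y powr r) \<partial>R)"
  proof -
    have "ennreal (N powr r * I) = (\<integral>\<^sup>+\<omega>. ennreal (N powr r * V \<omega>) \<partial>M)"
      using V_int V_nonneg N(2) unfolding I_def by (subst nn_integral_eq_integral) auto
    also have "\<dots> = (\<integral>\<^sup>+\<omega>. ennreal (U (T \<omega>) powr r) \<partial>M)"
      using V_U by (intro nn_integral_cong_AE) auto
    also have "\<dots> = (\<integral>\<^sup>+y. ennreal (U y powr r) \<partial>R)"
      using U_meas by (intro pushforward) measurable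
    finally show ?thesis .
  qed
  have tau_pos: "0 < tau (2 * r)"
    using r by (simp add: tau_eq_Gamma Gamma_real_pos)

  have bounds: "ereal (N powr r * I) \<le> sqrt_ereal (exp_ereal \<Delta> * ereal (tau (2 * r))) \<and>
    ereal (N * I powr (1 / r)) \<le> ereal (1 / lam) * (ereal (ln (2 / (1 - lam))) + \<Delta> + ereal (2 * max (r - 1) 0))"
  proof (cases "D = \<infinity>")
    case True
    \<comment> \<open>Both right-hand sides are infinite; positivity of \<open>tau (2 * r)\<close>
      matters because \<open>\<infinity> * 0 = 0\<close> in \<open>ereal\<close>.\<close>
    then have "\<Delta> = \<infinity>" by (simp add: \<Delta>' ln_ennreal_def)
    then show ?thesis using tau_pos lam by (simp add: exp_ereal_def sqrt_ereal_def)
  next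
    case False
    then obtain d where d: "D = ennreal d" "0 \<le> d" by (cases D) auto
    then have d1: "1 \<le> d" using D1 by (simp flip: ennreal_1)
    then have \<Delta>_d: "\<Delta> = ereal (ln d)"
      using d by (simp add: \<Delta>' ln_ennreal_def)

    have CS: "(\<integral>\<^sup>+y. h y \<partial>R)\<^sup>2 \<le> (\<integral>\<^sup>+y. (h y)\<^sup>2 \<partial>Q) * ennreal d"
      if "h \<in> borel_measurable (PiM J (\<lambda>_. borel))" for h
      unfolding Q_def R_def d(1)[symmetric] D_def by (rule change_of_measure[OF J(1) g \<theta>' that])

    have "(ennreal (N powr r * I))\<^sup>2 \<le> (\<integral>\<^sup>+y. (ennreal (U y powr r))\<^sup>2 \<partial>Q) * ennreal d"
      unfolding I_R using U_meas by (intro CS) measurable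
    also have "(\<integral>\<^sup>+y. (ennreal (U y powr r))\<^sup>2 \<partial>Q) = (\<integral>\<^sup>+y. ennreal (U y powr (2 * r)) \<partial>Q)"
      by (simp add: power2_eq_square ennreal_mult'[symmetric] powr_add[symmetric])
    also have "\<dots> \<le> ennreal (tau (2 * r))"
      using r tail U_nonneg by (intro powr_moment_le_tau U_meas_QR prob_space_imp_sigma_finite prob_Q) auto
    finally have "(ennreal (N powr r * I))\<^sup>2 \<le> ennreal (tau (2 * r)) * ennreal d"
      by (simp add: mult_right_mono)
    then have "ennreal ((N powr r * I)\<^sup>2) \<le> ennreal (tau (2 * r) * d)"
      using I0 tau_pos by (subst ennreal_power[symmetric]) (auto simp: ennreal_mult')
    then have "(N powr r * I)\<^sup>2 \<le> d * tau (2 * r)"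
      using tau_pos d by (simp add: mult.commute)
    then have first: "N powr r * I \<le> sqrt (d * tau (2 * r))"
      by (rule real_le_rsqrt)

    define c where "c = max (r - 1) 0"
    \<comment> \<open>\<open>A - c\<close> is half the logarithm of the Cauchy-Schwarz bound
      \<open>2 / (1 - lam) * d\<close>, the half coming from the square root. With exponent
      \<open>lam / 2\<close>, whose square has exponent \<open>lam\<close>, the resulting bound
      \<open>2 * A / lam\<close> is the one claimed.\<close>
    define A where "A = (ln (2 / (1 - lam)) + ln d) / 2 + c"
    have "0 < ln (2 / (1 - lam))" using lam by (intro ln_gt_zero) (simp add: field_simps)
    then have A: "c < A" using d1 by (simp add: A_def add_pos_nonneg)
    have expA: "(exp (A - c))\<^sup>2 = 2 / (1 - lam) * d"
      using lam d1 by (simp add: A_def exp_add power2_eq_square mult_exp_exp)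
    have "(\<integral>\<^sup>+y. ennreal (exp (lam / 2 * U y)) \<partial>R)\<^sup>2
        \<le> (\<integral>\<^sup>+y. (ennreal (exp (lam / 2 * U y)))\<^sup>2 \<partial>Q) * ennreal d"
      using U_meas by (intro CS) measurable
    also have "(\<integral>\<^sup>+y. (ennreal (exp (lam / 2 * U y)))\<^sup>2 \<partial>Q) = (\<integral>\<^sup>+y. ennreal (exp (lam * U y)) \<partial>Q)"
      by (simp add: power2_eq_square ennreal_mult'[symmetric] mult_exp_exp)
    also have "\<dots> \<le> ennreal (2 / (1 - lam))"
      using lam tail U_nonneg by (intro exp_moment_le U_meas_QR prob_Q) auto
    finally have "(\<integral>\<^sup>+y. ennreal (exp (lam / 2 * U y)) \<partial>R)\<^sup>2 \<le> ennreal (2 / (1 - lam)) * ennreal d"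
      by (simp add: mult_right_mono)
    also have "\<dots> = (ennreal (exp (A - c)))\<^sup>2"
      using lam d by (simp add: ennreal_power expA ennreal_mult'[symmetric])
    finally have "(\<integral>\<^sup>+y. ennreal (exp (lam / 2 * U y)) \<partial>R) \<le> ennreal (exp (A - c))"
      by (rule ennreal_power2_le_imp_le) simp
    then have "(\<integral>\<^sup>+y. ennreal (U y powr r) \<partial>R) \<le> ennreal ((A / (lam / 2)) powr r)"
      using A r lam U_nonneg unfolding c_def
      by (intro powr_moment_le_of_exp_moment prob_R U_meas_QR) auto
    then have "N powr r * I \<le> (2 * A / lam) powr r"
      unfolding I_R[symmetric] by (simp add: mult.commute)
    then have "(N powr r * I) powr (1 / r) \<le> ((2 * A / lam) powr r) powr (1 / r)"
      using r I0 by (intro powr_mono2) auto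
    also have "\<dots> = 2 * A / lam"
      using r lam A by (simp add: powr_powr c_def)
    also have "(N powr r * I) powr (1 / r) = N * I powr (1 / r)"
      using r I0 N(2) by (simp add: powr_mult powr_powr)
    finally have "N * I powr (1 / r) \<le> 1 / lam * (ln (2 / (1 - lam)) + ln d + 2 * c)"
      by (simp add: A_def add_divide_distrib algebra_simps)
    with first show ?thesis
      using d1 by (simp add: \<Delta>_d exp_ereal_def sqrt_ereal_def c_def)
  qed
  show ?thesis
    using V_int bounds by (simp add: I_def V_def[abs_def])
qed

end
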